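(* Let $\Omega \subseteq \mathbb{C}^n$ be a domain with envelope of holomorphy $(\tilde\Omega, \pi)$ and associated inclusion $\alpha \colon \Omega \to \tilde\Omega$. Let $\Omega' = \pi(\tilde\Omega) \subseteq \mathbb{C}^n$ and let $i = \pi \circ \alpha \colon \Omega \to \Omega'$ (the inclusion map). If $\pi \colon \tilde\Omega \to \Omega'$ is a covering map and the induced homomorphism $i_* \colon \pi_1(\Omega) \to \pi_1(\Omega')$ is surjective, then $(\tilde\Omega, \pi)$ is schlicht, i.e. $\pi \colon \tilde\Omega \to \Omega'$ is biholomorphic.
   Context: A domain is a nonempty connected open set. The envelope of holomorphy of a domain $\Omega \subseteq \mathbb{C}^n$ is a pair $(\tilde\Omega, \pi)$ consisting of a connected Stein manifold $\tilde\Omega$ and a locally biholomorphic map $\pi \colon \tilde\Omega \to \mathbb{C}^n$, together with a holomorphic inclusion $\alpha \colon \Omega \to \tilde\Omega$, characterized by the following properties: $\pi \circ \alpha$ is the identity on $\Omega$ (i.e. the inclusion of $\Omega$ into $\mathbb{C}^n$), and each holomorphic function $f$ on $\Omega$ has a unique holomorphic extension $F_f$ on $\tilde\Omega$ with $f = F_f \circ \alpha$. The envelope of holomorphy $(\tilde\Omega, \pi)$ is called schlicht if $\pi \colon \tilde\Omega \to \Omega' = \pi(\tilde\Omega)$ is biholomorphic. Fundamental groups are taken with compatible base points: $p \in \Omega$ and $i(p) = p \in \Omega'$. *)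

theory Defs
  imports "HOL-Analysis.Analysis" "HOL-Algebra.Group"
begin

section \<open>Holomorphic functions of several variables\<close>

definition is_domain :: "(complex^'n) set \<Rightarrow> bool" where
  "is_domain S \<longleftrightarrow> S \<noteq> {} \<and> connected S \<and> open S"

text \<open>Holomorphic means complex differentiable: the Frechet derivative is \<open>\<complex>\<close>-linear.
  The notion is only used for open \<open>S\<close>.\<close>

definition holomorphic_Cn :: "(complex^'n) set \<Rightarrow> (complex^'n \<Rightarrow> complex) \<Rightarrow> bool" where
  "holomorphic_Cn S f \<longleftrightarrow>
     (\<forall>z\<in>S. \<exists>D. (f has_derivative D) (at z within S) \<and> (\<forall>c v. D (c *s v) = c * D v))"

definition holomorphic_map_Cn :: "(complex^'n) set \<Rightarrow> (complex^'n \<Rightarrow> complex^'m) \<Rightarrow> bool" where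
  "holomorphic_map_Cn S f \<longleftrightarrow> (\<forall>i. holomorphic_Cn S (\<lambda>z. f z $ i))"


section \<open>Complex manifolds\<close>

text \<open>A manifold is a subset \<open>M\<close> of a topological space, with the subspace topology, together
  with an atlas: a set of pairs (chart domain, coordinate map). Coordinate maps and functions on
  \<open>M\<close> are total functions whose values outside their domain are irrelevant. The atlas need not
  be maximal.\<close>

type_synonym ('a, 'n) chart = "'a set \<times> ('a \<Rightarrow> complex^'n)"

definition complex_atlas :: "'a::topological_space set \<Rightarrow> ('a, 'n::finite) chart set \<Rightarrow> bool" where
  "complex_atlas M A \<longleftrightarrow>
     (\<Union>(U, \<phi>)\<in>A. U) = M \<and>
     (\<forall>(U, \<phi>)\<in>A. openin (top_of_set M) U \<and> open (\<phi> ` U) \<and>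
        homeomorphism U (\<phi> ` U) \<phi> (inv_into U \<phi>)) \<and>
     (\<forall>(U, \<phi>)\<in>A. \<forall>(V, \<psi>)\<in>A. holomorphic_map_Cn (\<phi> ` (U \<inter> V)) (\<psi> \<circ> inv_into U \<phi>))"

definition complex_manifold :: "'a::topological_space set \<Rightarrow> ('a, 'n::finite) chart set \<Rightarrow> bool" where
  "complex_manifold M A \<longleftrightarrow>
     Hausdorff_space (top_of_set M) \<and> second_countable (top_of_set M) \<and> complex_atlas M A"

definition Cn_atlas :: "(complex^'n) set \<Rightarrow> (complex^'n, 'n::finite) chart set" where
  "Cn_atlas S = {(S, id)}"

definition restrict_atlas :: "('a, 'n::finite) chart set \<Rightarrow> 'a set \<Rightarrow> ('a, 'n) chart set" where
  "restrict_atlas A W = {(U \<inter> W, \<phi>) | U \<phi>. (U, \<phi>) \<in> A}"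

definition holomorphic_functions ::
    "'a::topological_space set \<Rightarrow> ('a, 'n::finite) chart set \<Rightarrow> ('a \<Rightarrow> complex) set" where
  "holomorphic_functions M A =
     {f. \<forall>(U, \<phi>)\<in>A. holomorphic_Cn (\<phi> ` U) (f \<circ> inv_into U \<phi>)}"

definition holomorphic_map ::
    "'a::topological_space set \<Rightarrow> ('a, 'n::finite) chart set \<Rightarrow>
     'b::topological_space set \<Rightarrow> ('b, 'm::finite) chart set \<Rightarrow> ('a \<Rightarrow> 'b) \<Rightarrow> bool" where
  "holomorphic_map M A N B f \<longleftrightarrow>
     f \<in> M \<rightarrow> N \<and> continuous_on M f \<and>
     (\<forall>(U, \<phi>)\<in>A. \<forall>(V, \<psi>)\<in>B.
        holomorphic_map_Cn (\<phi> ` (U \<inter> f -` V)) (\<psi> \<circ> f \<circ> inv_into U \<phi>))"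

definition biholomorphic ::
    "'a::topological_space set \<Rightarrow> ('a, 'n::finite) chart set \<Rightarrow>
     'b::topological_space set \<Rightarrow> ('b, 'm::finite) chart set \<Rightarrow> ('a \<Rightarrow> 'b) \<Rightarrow> bool" where
  "biholomorphic M A N B f \<longleftrightarrow>
     (\<exists>g. holomorphic_map M A N B f \<and> holomorphic_map N B M A g \<and>
          (\<forall>x\<in>M. g (f x) = x) \<and> (\<forall>y\<in>N. f (g y) = y))"

definition locally_biholomorphic ::
    "'a::topological_space set \<Rightarrow> ('a, 'n::finite) chart set \<Rightarrow>
     'b::topological_space set \<Rightarrow> ('b, 'm::finite) chart set \<Rightarrow> ('a \<Rightarrow> 'b) \<Rightarrow> bool" where
  "locally_biholomorphic M A N B f \<longleftrightarrow>
     (\<forall>x\<in>M. \<exists>U V. x \<in> U \<and> openin (top_of_set M) U \<and> openin (top_of_set N) V \<and>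
        biholomorphic U (restrict_atlas A U) V (restrict_atlas B V) f)"


section \<open>Stein manifolds\<close>

definition holomorphic_hull ::
    "'a::topological_space set \<Rightarrow> ('a, 'n::finite) chart set \<Rightarrow> 'a set \<Rightarrow> 'a set" where
  "holomorphic_hull M A K =
     {x\<in>M. \<forall>f\<in>holomorphic_functions M A. cmod (f x) \<le> (SUP y\<in>K. cmod (f y))}"

definition holomorphically_convex ::
    "'a::topological_space set \<Rightarrow> ('a, 'n::finite) chart set \<Rightarrow> bool" where
  "holomorphically_convex M A \<longleftrightarrow>
     (\<forall>K. K \<subseteq> M \<and> K \<noteq> {} \<and> compact K \<longrightarrow> compact (holomorphic_hull M A K))"

definition holomorphically_separable ::
    "'a::topological_space set \<Rightarrow> ('a, 'n::finite) chart set \<Rightarrow> bool" where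
  "holomorphically_separable M A \<longleftrightarrow>
     (\<forall>x\<in>M. \<forall>y\<in>M. x \<noteq> y \<longrightarrow> (\<exists>f\<in>holomorphic_functions M A. f x \<noteq> f y))"

definition global_local_coordinates ::
    "'a::topological_space set \<Rightarrow> ('a, 'n::finite) chart set \<Rightarrow> bool" where
  "global_local_coordinates M A \<longleftrightarrow>
     (\<forall>x\<in>M. \<exists>(F :: 'a \<Rightarrow> complex^'n) U.
        (\<forall>i. (\<lambda>y. F y $ i) \<in> holomorphic_functions M A) \<and>
        x \<in> U \<and> openin (top_of_set M) U \<and> open (F ` U) \<and>
        biholomorphic U (restrict_atlas A U) (F ` U) (Cn_atlas (F ` U)) F)"

text \<open>Hoermander's definition; countability at infinity is part of \<open>complex_manifold\<close>.\<close>

definition stein_manifold :: "'a::topological_space set \<Rightarrow> ('a, 'n::finite) chart set \<Rightarrow> bool" where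
  "stein_manifold M A \<longleftrightarrow>
     complex_manifold M A \<and> holomorphically_convex M A \<and>
     holomorphically_separable M A \<and> global_local_coordinates M A"


section \<open>The envelope of holomorphy\<close>

definition envelope_of_holomorphy ::
    "(complex^'n) set \<Rightarrow> 'a::topological_space set \<Rightarrow> ('a, 'n::finite) chart set \<Rightarrow>
     ('a \<Rightarrow> complex^'n) \<Rightarrow> (complex^'n \<Rightarrow> 'a) \<Rightarrow> bool" where
  "envelope_of_holomorphy \<Omega> M A \<pi> \<alpha> \<longleftrightarrow>
     stein_manifold M A \<and> connected M \<and>
     locally_biholomorphic M A UNIV (Cn_atlas UNIV) \<pi> \<and>
     holomorphic_map \<Omega> (Cn_atlas \<Omega>) M A \<alpha> \<and> inj_on \<alpha> \<Omega> \<and>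
     (\<forall>z\<in>\<Omega>. \<pi> (\<alpha> z) = z) \<and>
     (\<forall>f. holomorphic_Cn \<Omega> f \<longrightarrow>
        (\<exists>F\<in>holomorphic_functions M A. (\<forall>z\<in>\<Omega>. F (\<alpha> z) = f z) \<and>
           (\<forall>G\<in>holomorphic_functions M A. (\<forall>z\<in>\<Omega>. G (\<alpha> z) = f z) \<longrightarrow> (\<forall>x\<in>M. G x = F x))))"

definition schlicht ::
    "'a::topological_space set \<Rightarrow> ('a, 'n::finite) chart set \<Rightarrow> ('a \<Rightarrow> complex^'n) \<Rightarrow> bool" where
  "schlicht M A \<pi> \<longleftrightarrow> biholomorphic M A (\<pi> ` M) (Cn_atlas (\<pi> ` M)) \<pi>"


section \<open>The fundamental group\<close>

definition loops_at :: "'a::topological_space set \<Rightarrow> 'a \<Rightarrow> (real \<Rightarrow> 'a) set" where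
  "loops_at S p = {g. path g \<and> path_image g \<subseteq> S \<and> pathstart g = p \<and> pathfinish g = p}"

definition path_class :: "'a::topological_space set \<Rightarrow> (real \<Rightarrow> 'a) \<Rightarrow> (real \<Rightarrow> 'a) set" where
  "path_class S g = {h. homotopic_paths S g h}"

definition fundamental_group ::
    "'a::topological_space set \<Rightarrow> 'a \<Rightarrow> (real \<Rightarrow> 'a) set monoid" where
  "fundamental_group S p =
     \<lparr>carrier = path_class S ` loops_at S p,
      mult = (\<lambda>X Y. \<Union>f\<in>X. \<Union>g\<in>Y. path_class S (f +++ g)),
      one = path_class S (\<lambda>_. p)\<rparr>"

text \<open>\<open>induced_map T f\<close> sends the class of \<open>g\<close> to the class of \<open>f \<circ> g\<close> in \<open>T\<close>.\<close>

definition induced_map ::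
    "'b::topological_space set \<Rightarrow> ('a \<Rightarrow> 'b) \<Rightarrow> (real \<Rightarrow> 'a) set \<Rightarrow> (real \<Rightarrow> 'b) set" where
  "induced_map T f X = (\<Union>g\<in>X. path_class T (f \<circ> g))"

lemma path_class_eq: "homotopic_paths S g h \<Longrightarrow> path_class S g = path_class S h"
  unfolding path_class_def by (blast intro: homotopic_paths_sym homotopic_paths_trans)

lemma path_class_self: "g \<in> loops_at S p \<Longrightarrow> g \<in> path_class S g"
  by (simp add: path_class_def loops_at_def)

lemma path_class_eqD:
  assumes "path_class S g = path_class S h" "h \<in> loops_at S p"
  shows "homotopic_paths S g h"
proof -
  have "h \<in> path_class S g"
    using path_class_self[OF assms(2)] by (simp only: assms(1))
  then show ?thesis
    by (simp add: path_class_def)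
qed

lemma loops_at_join: "\<lbrakk>f \<in> loops_at S p; g \<in> loops_at S p\<rbrakk> \<Longrightarrow> f +++ g \<in> loops_at S p"
  by (auto simp: loops_at_def path_image_join)

lemma mult_path_class:
  assumes "f \<in> loops_at S p" "g \<in> loops_at S p"
  shows "path_class S f \<otimes>\<^bsub>fundamental_group S p\<^esub> path_class S g = path_class S (f +++ g)"
proof -
  have *: "path_class S (f' +++ g') = path_class S (f +++ g)"
    if "f' \<in> path_class S f" "g' \<in> path_class S g" for f' g'
    using that assms path_class_eq[OF homotopic_paths_join[of S f f' g g']]
    by (simp add: path_class_def loops_at_def)
  have "path_class S f \<otimes>\<^bsub>fundamental_group S p\<^esub> path_class S g =
      (\<Union>f'\<in>path_class S f. \<Union>g'\<in>path_class S g. path_class S (f +++ g))"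
    unfolding fundamental_group_def monoid.simps by (intro SUP_cong refl *)
  also have "\<dots> = path_class S (f +++ g)"
    using assms[THEN path_class_self] by blast
  finally show ?thesis .
qed

lemma induced_map_path_class:
  assumes "g \<in> loops_at S p" "continuous_on S f" "f \<in> S \<rightarrow> T"
  shows "induced_map T f (path_class S g) = path_class T (f \<circ> g)"
proof -
  have *: "path_class T (f \<circ> g') = path_class T (f \<circ> g)" if "g' \<in> path_class S g" for g'
    using that path_class_eq[OF homotopic_paths_continuous_image[OF _ assms(2,3), of g g']]
    by (simp add: path_class_def)
  have "induced_map T f (path_class S g) = (\<Union>g'\<in>path_class S g. path_class T (f \<circ> g))"
    unfolding induced_map_def by (intro SUP_cong refl *)
  also have "\<dots> = path_class T (f \<circ> g)"
    using path_class_self[OF assms(1)] by blast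
  finally show ?thesis .
qed

lemma group_fundamental_group:
  fixes p :: "'a::real_normed_vector"
  assumes "p \<in> S"
  shows "group (fundamental_group S p)"
proof (rule groupI)
  let ?G = "fundamental_group S p"
  have car: "carrier ?G = path_class S ` loops_at S p" and one: "\<one>\<^bsub>?G\<^esub> = path_class S (linepath p p)"
    by (simp_all add: fundamental_group_def linepath_refl)
  have lin: "linepath p p \<in> loops_at S p"
    using assms by (simp add: loops_at_def)
  show "\<one>\<^bsub>?G\<^esub> \<in> carrier ?G"
    using lin by (simp add: car one)
  show "X \<otimes>\<^bsub>?G\<^esub> Y \<in> carrier ?G" if "X \<in> carrier ?G" "Y \<in> carrier ?G" for X Y
    using that by (auto simp: car mult_path_class intro!: imageI loops_at_join)
  show "X \<otimes>\<^bsub>?G\<^esub> Y \<otimes>\<^bsub>?G\<^esub> Z = X \<otimes>\<^bsub>?G\<^esub> (Y \<otimes>\<^bsub>?G\<^esub> Z)"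
    if XYZ: "X \<in> carrier ?G" "Y \<in> carrier ?G" "Z \<in> carrier ?G" for X Y Z
  proof -
    obtain x y z where l: "x \<in> loops_at S p" "y \<in> loops_at S p" "z \<in> loops_at S p"
      and eq: "X = path_class S x" "Y = path_class S y" "Z = path_class S z"
      using XYZ by (auto simp: car)
    have assoc: "homotopic_paths S (x +++ (y +++ z)) ((x +++ y) +++ z)"
      using l by (intro homotopic_paths_assoc) (auto simp: loops_at_def)
    then show ?thesis
      using l by (simp add: eq mult_path_class loops_at_join path_class_eq[OF assoc])
  qed
  show "\<one>\<^bsub>?G\<^esub> \<otimes>\<^bsub>?G\<^esub> X = X" if X: "X \<in> carrier ?G" for X
  proof -
    obtain x where x: "x \<in> loops_at S p" "X = path_class S x"
      using X by (auto simp: car)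
    then have "path_class S (linepath p p +++ x) = path_class S x"
      by (intro path_class_eq homotopic_paths_lid') (auto simp: loops_at_def)
    then show ?thesis
      using x lin by (simp add: one mult_path_class)
  qed
  show "\<exists>Y\<in>carrier ?G. Y \<otimes>\<^bsub>?G\<^esub> X = \<one>\<^bsub>?G\<^esub>" if X: "X \<in> carrier ?G" for X
  proof -
    obtain x where x: "x \<in> loops_at S p" "X = path_class S x"
      using X by (auto simp: car)
    have r: "reversepath x \<in> loops_at S p"
      using x by (auto simp: loops_at_def)
    have "path_class S (reversepath x +++ x) = path_class S (linepath p p)"
      using homotopic_paths_linv[of x S] x by (intro path_class_eq) (auto simp: loops_at_def)
    with x r show ?thesis
      by (intro bexI[of _ "path_class S (reversepath x)"]) (auto simp: car one mult_path_class)
  qed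
qed

lemma induced_map_hom:
  assumes f: "continuous_on S f" "f \<in> S \<rightarrow> T"
  shows "induced_map T f \<in> hom (fundamental_group S p) (fundamental_group T (f p))"
proof -
  have l: "f \<circ> g \<in> loops_at T (f p)" if "g \<in> loops_at S p" for g
  proof -
    have "path (f \<circ> g)"
      using that f by (intro path_continuous_image continuous_on_subset[OF f(1)]) (auto simp: loops_at_def)
    then show ?thesis
      using that f by (auto simp: loops_at_def path_image_compose pathstart_compose pathfinish_compose)
  qed
  have car: "carrier (fundamental_group S p) = path_class S ` loops_at S p"
    "carrier (fundamental_group T (f p)) = path_class T ` loops_at T (f p)"
    by (simp_all add: fundamental_group_def)
  show ?thesis
    by (rule homI)
      (auto simp: car mult_path_class loops_at_join induced_map_path_class[OF _ f, where p = p] l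
        path_compose_join)
qed

end

theory Submission
  imports Defs
begin

text \<open>By the monodromy theorem a connected covering is injective as soon as every loop in the base
  is homotopic to the projection of a loop upstairs. Since \<open>\<pi> \<circ> \<alpha>\<close> is the identity on \<open>\<Omega>\<close>, surjectivity
  on fundamental groups provides such loops: they are the images under \<open>\<alpha>\<close> of loops in \<open>\<Omega>\<close>.
  An injective locally biholomorphic map is biholomorphic onto its image. The monodromy theorem
  of \<open>HOL-Analysis\<close> is restricted to normed vector spaces, whereas \<open>M\<close> lies in an arbitrary
  topological space.\<close>

section \<open>Monodromy in covering spaces\<close>

text \<open>Every point of \<open>T\<close> has a neighbourhood \<open>W\<close> on which
  \<open>g1\<close> and \<open>g2\<close> each stay in one sheet over the same \<open>V\<close>.
  Agreement at a single point of \<open>W\<close> makes these sheets equal, since distinct ones are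
  disjoint, and \<open>p\<close> is injective on a sheet. Hence agreement at one point of
  \<open>W\<close> spreads over \<open>W\<close>, and from \<open>a\<close> over the connected set
  \<open>T\<close>.\<close>

lemma covering_space_lift_unique_topological:
  fixes p :: "'a::topological_space \<Rightarrow> 'b::topological_space"
    and T :: "'c::topological_space set"
  assumes cov: "covering_space C p S"
    and g1: "continuous_on T g1" "g1 \<in> T \<rightarrow> C"
    and g2: "continuous_on T g2" "g2 \<in> T \<rightarrow> C"
    and eq: "\<And>x. x \<in> T \<Longrightarrow> p (g1 x) = p (g2 x)"
    and T: "connected T" "a \<in> T" "g1 a = g2 a" "x \<in> T"
  shows "g1 x = g2 x"
proof (rule connected_induction_simple[OF T(1,2,4), where P = "\<lambda>x. g1 x = g2 x"])
  show "g1 a = g2 a" by fact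
next
  fix x assume x: "x \<in> T"
  then have gx: "g1 x \<in> C" "g2 x \<in> C" using g1 g2 by auto
  then have "p (g1 x) \<in> S" using cov by (auto simp: covering_space_def)
  then obtain V \<U> where V: "p (g1 x) \<in> V" "\<Union>\<U> = C \<inter> p -` V"
    and \<U>: "\<And>u. u \<in> \<U> \<Longrightarrow> openin (top_of_set C) u" "pairwise disjnt \<U>"
      "\<And>u. u \<in> \<U> \<Longrightarrow> \<exists>q. homeomorphism u V p q"
    using cov unfolding covering_space_def by metis
  have "g1 x \<in> \<Union>\<U>" "g2 x \<in> \<Union>\<U>"
    using V gx eq[OF x] by auto
  then obtain u1 u2 where u: "u1 \<in> \<U>" "g1 x \<in> u1" "u2 \<in> \<U>" "g2 x \<in> u2"
    by blast
  define W where "W = (T \<inter> g1 -` u1) \<inter> (T \<inter> g2 -` u2)"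
  have "openin (top_of_set T) W"
    unfolding W_def using g1 g2 \<U>(1) u
    by (intro openin_Int continuous_openin_preimage[where T = C]) auto
  moreover have "x \<in> W" using x u by (simp add: W_def)
  moreover have "g1 z = g2 z" if yz: "y \<in> W" "z \<in> W" "g1 y = g2 y" for y z
  proof -
    have "u1 = u2"
      using yz u \<U>(2) unfolding W_def pairwise_def disjnt_def by auto
    then have "g1 z \<in> u1" "g2 z \<in> u1" "p (g1 z) = p (g2 z)"
      using yz eq by (auto simp: W_def)
    moreover have "inj_on p u1"
      using \<U>(3)[OF u(1)] by (metis homeomorphism_def inj_on_inverseI)
    ultimately show ?thesis by (auto dest: inj_onD)
  qed
  ultimately show "\<exists>W. openin (top_of_set T) W \<and> x \<in> W \<and>
      (\<forall>y\<in>W. \<forall>z\<in>W. g1 y = g2 y \<longrightarrow> g1 z = g2 z)"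
    by blast
qed

section \<open>Existence of lifts\<close>

text \<open>The quantification over every base point \<open>t\<close> and every point
  \<open>a\<close> of its fibre makes the property fit for gluing: a lift can be continued on a
  neighbouring piece from whatever value it has reached.\<close>

definition lifts_on ::
    "'a::topological_space set \<Rightarrow> ('a \<Rightarrow> 'b) \<Rightarrow> ('c::topological_space \<Rightarrow> 'b) \<Rightarrow> 'c set \<Rightarrow> bool" where
  "lifts_on C p f R \<longleftrightarrow>
     (\<forall>t\<in>R. \<forall>a\<in>C. p a = f t \<longrightarrow>
        (\<exists>k. continuous_on R k \<and> k \<in> R \<rightarrow> C \<and> (\<forall>s\<in>R. p (k s) = f s) \<and> k t = a))"

text \<open>The point \<open>a\<close> lies in some sheet \<open>u\<close>, and composing
  \<open>f\<close> with the inverse \<open>q\<close> of \<open>p\<close> on that sheet gives the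
  lift through \<open>a\<close>.\<close>

lemma lifts_on_evenly_covered:
  assumes f: "continuous_on R f" "f \<in> R \<rightarrow> V"
    and V: "\<Union>\<U> = C \<inter> p -` V" "\<And>u. u \<in> \<U> \<Longrightarrow> \<exists>q. homeomorphism u V p q"
  shows "lifts_on C p f R"
  unfolding lifts_on_def
proof (intro ballI impI)
  fix t a assume t: "t \<in> R" "a \<in> C" "p a = f t"
  then have "a \<in> \<Union>\<U>" using f V by auto
  then obtain u q where u: "u \<in> \<U>" "a \<in> u" "homeomorphism u V p q"
    using V(2) by blast
  have q: "continuous_on V q" "q ` V = u" "\<And>y. y \<in> V \<Longrightarrow> p (q y) = y" "q (p a) = a"
    using u by (auto simp: homeomorphism_def)
  have "u \<subseteq> C" using u(1) V(1) by blast
  have "continuous_on R (q \<circ> f)"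
    using q(1) f by (intro continuous_on_compose) (auto intro: continuous_on_subset)
  moreover have "q \<circ> f \<in> R \<rightarrow> C"
    using q(2) f(2) \<open>u \<subseteq> C\<close> by fastforce
  moreover have "\<forall>s\<in>R. p ((q \<circ> f) s) = f s"
    using q(3) f(2) by auto
  moreover have "(q \<circ> f) t = a"
    using q(4) t(3) by simp
  ultimately show "\<exists>k. continuous_on R k \<and> k \<in> R \<rightarrow> C \<and> (\<forall>s\<in>R. p (k s) = f s) \<and> k t = a"
    by blast
qed

text \<open>A lift on the piece containing \<open>t\<close> is continued on the other piece from its
  value at a common point. Uniqueness of lifts on the connected overlap makes the two agree there,
  and closedness of the pieces makes the pasted map continuous.\<close>

lemma lifts_on_Un:
  assumes cov: "covering_space C p S"
    and R: "closed R1" "closed R2" "connected (R1 \<inter> R2)" "R1 \<inter> R2 \<noteq> {}"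
    and lifts: "lifts_on C p f R1" "lifts_on C p f R2"
  shows "lifts_on C p f (R1 \<union> R2)"
proof -
  \<comment> \<open>Stated for arbitrary pieces with the base point in the first, so that it applies
    to \<open>R1\<close> and \<open>R2\<close> in either order.\<close>
  have *: "\<exists>k. continuous_on (Q1 \<union> Q2) k \<and> k \<in> Q1 \<union> Q2 \<rightarrow> C \<and> (\<forall>s\<in>Q1 \<union> Q2. p (k s) = f s) \<and> k t = a"
    if Q: "closed Q1" "closed Q2" "connected (Q1 \<inter> Q2)" "Q1 \<inter> Q2 \<noteq> {}"
      "lifts_on C p f Q1" "lifts_on C p f Q2" and t: "t \<in> Q1" "a \<in> C" "p a = f t" for Q1 Q2 t a
  proof -
    obtain k1 where k1: "continuous_on Q1 k1" "k1 \<in> Q1 \<rightarrow> C" "\<forall>s\<in>Q1. p (k1 s) = f s" "k1 t = a"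
      using Q(5) t unfolding lifts_on_def by blast
    obtain b where b: "b \<in> Q1" "b \<in> Q2" using Q(4) by blast
    then have "k1 b \<in> C" "p (k1 b) = f b" using k1 by auto
    then obtain k2 where k2: "continuous_on Q2 k2" "k2 \<in> Q2 \<rightarrow> C" "\<forall>s\<in>Q2. p (k2 s) = f s" "k2 b = k1 b"
      using Q(6) b unfolding lifts_on_def by meson
    have agree: "k1 x = k2 x" if "x \<in> Q1 \<inter> Q2" for x
    proof (rule covering_space_lift_unique_topological[OF cov, where T = "Q1 \<inter> Q2" and a = b])
      show "continuous_on (Q1 \<inter> Q2) k1" "continuous_on (Q1 \<inter> Q2) k2"
        using k1 k2 by (auto intro: continuous_on_subset)
    qed (use k1 k2 b Q that in auto)
    have "continuous_on (Q1 \<union> Q2) (\<lambda>x. if x \<in> Q1 then k1 x else k2 x)"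
      using Q k1 k2 agree by (intro continuous_on_cases) auto
    then show ?thesis
      using k1 k2 t by (intro exI[of _ "\<lambda>x. if x \<in> Q1 then k1 x else k2 x"]) auto
  qed
  show ?thesis
    unfolding lifts_on_def
  proof (intro ballI impI)
    fix t a assume t: "t \<in> R1 \<union> R2" "a \<in> C" "p a = f t"
    show "\<exists>k. continuous_on (R1 \<union> R2) k \<and> k \<in> R1 \<union> R2 \<rightarrow> C \<and>
        (\<forall>s\<in>R1 \<union> R2. p (k s) = f s) \<and> k t = a"
    proof (cases "t \<in> R1")
      case True
      then show ?thesis by (intro *[OF R lifts] t)
    next
      case False
      then have "t \<in> R2" using t(1) by simp
      have "connected (R2 \<inter> R1)" "R2 \<inter> R1 \<noteq> {}" using R by (simp_all add: Int_commute)
      from *[OF R(2,1) this lifts(2,1) \<open>t \<in> R2\<close> t(2,3)] show ?thesis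
        by (simp only: Un_commute[of R2 R1])
    qed
  qed
qed

text \<open>Bisecting twice reduces the unit square to rectangles below the Lebesgue number of the
  cover by preimages of evenly covered sets.\<close>

lemma lifts_on_unit_square:
  fixes f :: "real \<times> real \<Rightarrow> 'b::topological_space"
  assumes cov: "covering_space C p S"
    and f: "continuous_on ({0..1} \<times> {0..1}) f" "f \<in> {0..1} \<times> {0..1} \<rightarrow> S"
  shows "lifts_on C p f ({0..1} \<times> {0..1})"
proof -
  let ?Q = "{0..1} \<times> {0..1} :: (real \<times> real) set"
  define even where "even V \<longleftrightarrow> (\<exists>\<U>. \<Union>\<U> = C \<inter> p -` V \<and> (\<forall>u\<in>\<U>. \<exists>q. homeomorphism u V p q))"
    for V
  define \<G> where "\<G> = {G. open G \<and> (\<exists>V. even V \<and> f \<in> ?Q \<inter> G \<rightarrow> V)}"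
  have "compact ?Q" by (intro compact_Times compact_Icc)
  moreover have "?Q \<subseteq> \<Union>\<G>"
  proof
    fix x assume x: "x \<in> ?Q"
    then have "f x \<in> S" using f by auto
    then obtain V where V: "f x \<in> V" "openin (top_of_set S) V" "even V"
      using cov unfolding covering_space_def even_def by metis
    have "openin (top_of_set ?Q) (?Q \<inter> f -` V)"
      using f V by (intro continuous_openin_preimage) auto
    then obtain G where "open G" "?Q \<inter> f -` V = ?Q \<inter> G" by (auto simp: openin_open)
    then show "x \<in> \<Union>\<G>"
      using x V by (auto simp: \<G>_def intro!: exI[of _ G] exI[of _ V])
  qed
  ultimately obtain e where e: "0 < e" "\<And>x. x \<in> ?Q \<Longrightarrow> \<exists>G\<in>\<G>. ball x e \<subseteq> G"
    by (rule Heine_Borel_lemma) (auto simp: \<G>_def)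
  \<comment> \<open>With both sides shorter than \<open>e / 2\<close>, the rectangle lies in the
    ball of radius \<open>e\<close> about its corner \<open>(a, c)\<close>, so \<open>f\<close> maps
    it into one evenly covered set.\<close>
  have small: "lifts_on C p f ({a..b} \<times> {c..d})"
    if abcd: "0 \<le> a" "a \<le> b" "b \<le> 1" "0 \<le> c" "c \<le> d" "d \<le> 1" "b - a < e / 2" "d - c < e / 2"
    for a b c d
  proof -
    have sub: "{a..b} \<times> {c..d} \<subseteq> ?Q" using abcd by auto
    have "(a, c) \<in> ?Q" using abcd by auto
    then obtain G where "G \<in> \<G>" and G: "ball (a, c) e \<subseteq> G" using e by blast
    then obtain V where V: "even V" "f \<in> ?Q \<inter> G \<rightarrow> V" by (auto simp: \<G>_def)
    have "{a..b} \<times> {c..d} \<subseteq> ball (a, c) e"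
    proof clarify
      fix x y assume xy: "x \<in> {a..b}" "y \<in> {c..d}"
      have "dist (a, c) (x, y) \<le> dist a x + dist c y"
        by (simp add: dist_Pair_Pair sqrt_sum_squares_le_sum)
      also have "\<dots> < e" using xy abcd by (auto simp: dist_real_def)
      finally show "(x, y) \<in> ball (a, c) e" by simp
    qed
    then have "f \<in> {a..b} \<times> {c..d} \<rightarrow> V" using V G sub by blast
    moreover obtain \<U> where "\<Union>\<U> = C \<inter> p -` V" "\<And>u. u \<in> \<U> \<Longrightarrow> \<exists>q. homeomorphism u V p q"
      using V(1) that unfolding even_def by metis
    ultimately show ?thesis
      by (rule lifts_on_evenly_covered[OF continuous_on_subset[OF f(1) sub]])
  qed
  have strip: "lifts_on C p f ({a..b} \<times> {0..1})"
    if ab: "0 \<le> a" "a \<le> b" "b \<le> 1" "b - a < e / 2" for a b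
  proof -
    \<comment> \<open>The premise is there because the local condition of \<open>Bolzano\<close>
      ranges over all short intervals around \<open>x\<close>, including those that leave the unit
      interval.\<close>
    define P where "P c d \<longleftrightarrow> (0 \<le> c \<and> c \<le> d \<and> d \<le> 1 \<longrightarrow> lifts_on C p f ({a..b} \<times> {c..d}))" for c d
    have "P 0 1"
    proof (rule Bolzano[of 0 1 P])
      fix c d d' assume P: "P c d" "P d d'" "c \<le> d" "d \<le> d'"
      have "{a..b} \<times> {c..d'} = {a..b} \<times> {c..d} \<union> {a..b} \<times> {d..d'}"
        using P(3,4) by auto
      moreover have "({a..b} \<times> {c..d}) \<inter> ({a..b} \<times> {d..d'}) = {a..b} \<times> {d}"
        using P(3,4) by auto
      ultimately show "P c d'"
        using P ab(2) lifts_on_Un[OF cov, of "{a..b} \<times> {c..d}" "{a..b} \<times> {d..d'}" f]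
        by (simp add: P_def closed_Times connected_Times)
    next
      fix x :: real
      show "\<exists>\<delta>>0. \<forall>c d. c \<le> x \<and> x \<le> d \<and> d - c < \<delta> \<longrightarrow> P c d"
        using small[OF ab(1-3)] ab(4) e(1) by (intro exI[of _ "e / 2"]) (simp add: P_def)
    qed simp
    then show ?thesis by (simp add: P_def)
  qed
  \<comment> \<open>Second bisection, now of the first coordinate: the pieces are full-height
    strips, and two neighbours meet in a vertical segment, which is connected.\<close>
  define P where "P a b \<longleftrightarrow> (0 \<le> a \<and> a \<le> b \<and> b \<le> 1 \<longrightarrow> lifts_on C p f ({a..b} \<times> {0..1}))" for a b
  have "P 0 1"
  proof (rule Bolzano[of 0 1 P])
    fix a b b' assume P: "P a b" "P b b'" "a \<le> b" "b \<le> b'"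
    have "{a..b'} \<times> {0..1::real} = {a..b} \<times> {0..1} \<union> {b..b'} \<times> {0..1}"
      using P(3,4) by auto
    moreover have "({a..b} \<times> {0..1::real}) \<inter> ({b..b'} \<times> {0..1}) = {b} \<times> {0..1}"
      using P(3,4) by auto
    ultimately show "P a b'"
      using P lifts_on_Un[OF cov, of "{a..b} \<times> {0..1}" "{b..b'} \<times> {0..1}" f]
      by (simp add: P_def closed_Times connected_Times)
  next
    fix x :: real
    show "\<exists>\<delta>>0. \<forall>a b. a \<le> x \<and> x \<le> b \<and> b - a < \<delta> \<longrightarrow> P a b"
      using strip e(1) by (intro exI[of _ "e / 2"]) (simp add: P_def)
  qed simp
  then show ?thesis by (simp add: P_def)
qed

section \<open>Monodromy and injectivity of coverings\<close>

text \<open>The homotopy is lifted to a map \<open>k\<close> on the unit square with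
  \<open>k (0, 0) = h1 0\<close>. Uniqueness of lifts then determines \<open>k\<close> on the edges:
  it is \<open>h1\<close> and \<open>h2\<close> on the edges carrying the paths, and constant on the
  two edges where the homotopy fixes endpoints. So the corner value \<open>k (1, 1)\<close> is the
  endpoint of both paths.\<close>

lemma covering_space_monodromy_topological:
  fixes p :: "'a::topological_space \<Rightarrow> 'b::topological_space"
  assumes cov: "covering_space C p S"
    and hom: "homotopic_paths S (p \<circ> h1) (p \<circ> h2)"
    and h1: "path h1" "path_image h1 \<subseteq> C"
    and h2: "path h2" "path_image h2 \<subseteq> C"
    and start: "pathstart h1 = pathstart h2"
  shows "pathfinish h1 = pathfinish h2"
proof -
  \<comment> \<open>The first coordinate is the homotopy parameter, the second the path
    parameter.\<close>
  obtain f where f: "continuous_on ({0..1} \<times> {0..1}) f" "f \<in> {0..1} \<times> {0..1} \<rightarrow> S"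
    and f0: "\<And>x. x \<in> {0..1} \<Longrightarrow> f (0, x) = p (h1 x)"
    and f1: "\<And>x. x \<in> {0..1} \<Longrightarrow> f (1, x) = p (h2 x)"
    and ends: "\<And>t. t \<in> {0..1::real} \<Longrightarrow> f (t, 0) = p (h1 0)" "\<And>t. t \<in> {0..1::real} \<Longrightarrow> f (t, 1) = p (h1 1)"
    using hom unfolding homotopic_paths pathstart_def pathfinish_def o_def by auto
  have hC: "h1 \<in> {0..1} \<rightarrow> C" "h2 \<in> {0..1} \<rightarrow> C"
    using h1 h2 by (auto simp: path_image_def)
  obtain k where k: "continuous_on ({0..1} \<times> {0..1}) k" "k \<in> {0..1} \<times> {0..1} \<rightarrow> C"
    and pk: "\<And>s. s \<in> {0..1} \<times> {0..1} \<Longrightarrow> p (k s) = f s" and k00: "k (0, 0) = h1 0"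
  proof -
    have "(0, 0) \<in> {0..1::real} \<times> {0..1::real}" "h1 0 \<in> C" "p (h1 0) = f (0, 0)"
      using Pi_mem[OF hC(1), of 0] f0[of 0] by simp_all
    then show ?thesis
      using lifts_on_unit_square[OF cov f] that unfolding lifts_on_def by blast
  qed
  \<comment> \<open>The curve \<open>c\<close> will run along an edge of the square, where
    \<open>g\<close> is the lift already known.\<close>
  have uniq: "k (c x) = g x"
    if c: "continuous_on {0..1} c" "c \<in> {0..1} \<rightarrow> {0..1} \<times> {0..1}"
      and g: "continuous_on {0..1} g" "g \<in> {0..1} \<rightarrow> C" "\<And>x. x \<in> {0..1} \<Longrightarrow> f (c x) = p (g x)"
      and start: "k (c 0) = g 0" and x: "x \<in> {0..1}" for c :: "real \<Rightarrow> real \<times> real" and g x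
  proof -
    have kc: "continuous_on {0..1} (k \<circ> c)"
      using c(2)
      by (intro continuous_on_compose[OF c(1)] continuous_on_subset[OF k(1)])
        (simp only: image_subset_iff_funcset)
    have kcC: "k \<circ> c \<in> {0..1} \<rightarrow> C"
      using Pi_mem[OF c(2)] Pi_mem[OF k(2)] by (intro Pi_I) simp
    have pkc: "p ((k \<circ> c) x) = p (g x)" if "x \<in> {0..1}" for x
      using pk[OF Pi_mem[OF c(2) that]] g(3)[OF that] by simp
    have "(k \<circ> c) x = g x"
      by (rule covering_space_lift_unique_topological[OF cov kc kcC g(1,2) pkc, where a = 0])
        (use start x in auto)
    then show ?thesis by simp
  qed
  have c1: "k (0, x) = h1 x" if "x \<in> {0..1}" for x
    by (rule uniq[of "\<lambda>x. (0, x)" h1])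
      (use that h1(1) hC(1) f0 k00 in \<open>auto simp: path_def intro!: continuous_intros\<close>)
  have "h1 0 \<in> C" "h1 1 \<in> C" using Pi_mem[OF hC(1)] by simp_all
  have left: "k (t, 0) = h1 0" if "t \<in> {0..1}" for t
    by (rule uniq[of "\<lambda>t. (t, 0)" "\<lambda>_. h1 0"])
      (use that \<open>h1 0 \<in> C\<close> ends k00 in \<open>auto intro!: continuous_intros\<close>)
  \<comment> \<open>The edge \<open>left\<close> carries the starting value from
    \<open>k (0, 0)\<close> to \<open>k (1, 0)\<close>, which is \<open>h2 0\<close> because both
    paths start at the same point.\<close>
  have c2: "k (1, x) = h2 x" if "x \<in> {0..1}" for x
    by (rule uniq[of "\<lambda>x. (1, x)" h2])
      (use that h2(1) hC(2) f1 left[of 1] start in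
        \<open>auto simp: path_def pathstart_def intro!: continuous_intros\<close>)
  have "k (1, 1) = h1 1"
    by (rule uniq[of "\<lambda>t. (t, 1)" "\<lambda>_. h1 1"])
      (use \<open>h1 1 \<in> C\<close> ends c1[of 1] in \<open>auto intro!: continuous_intros\<close>)
  then show ?thesis using c2[of 1] by (simp add: pathfinish_def)
qed

text \<open>A loop \<open>p \<circ> c1\<close> followed by the reverse of \<open>p \<circ> c2\<close> is homotopic to the image of a loop
  \<open>\<gamma>\<close>, so \<open>c1\<close> and \<open>\<gamma>\<close> followed by \<open>c2\<close> lift homotopic paths.\<close>

lemma covering_space_inj_on:
  fixes p :: "'a::topological_space \<Rightarrow> 'b::real_normed_vector"
  assumes cov: "covering_space C p S" and C: "path_connected C" "a \<in> C"
    and loops: "\<And>g. g \<in> loops_at S (p a) \<Longrightarrow> \<exists>\<gamma>\<in>loops_at C a. homotopic_paths S g (p \<circ> \<gamma>)"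
  shows "inj_on p C"
proof (rule inj_onI)
  fix x y assume xy: "x \<in> C" "y \<in> C" "p x = p y"
  obtain c1 c2 where c1: "path c1" "path_image c1 \<subseteq> C" "pathstart c1 = a" "pathfinish c1 = x"
    and c2: "path c2" "path_image c2 \<subseteq> C" "pathstart c2 = a" "pathfinish c2 = y"
    using C xy unfolding path_connected_def by metis
  have im: "path (p \<circ> c)" "path_image (p \<circ> c) \<subseteq> S" if "path c" "path_image c \<subseteq> C" for c
    using that cov unfolding covering_space_def
    by (auto simp: path_image_compose intro!: path_continuous_image intro: continuous_on_subset)
  let ?d1 = "p \<circ> c1" and ?d2 = "p \<circ> c2"
  note d = im[OF c1(1,2)] im[OF c2(1,2)]
  have ends: "pathstart ?d1 = p a" "pathstart ?d2 = p a" "pathfinish ?d1 = p x" "pathfinish ?d2 = p x"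
    using c1 c2 xy by (auto simp: pathstart_compose pathfinish_compose)
  \<comment> \<open>The paths close up to a loop because \<open>p x = p y\<close>.\<close>
  have "?d1 +++ reversepath ?d2 \<in> loops_at S (p a)"
    using d ends by (simp add: loops_at_def subset_path_image_join)
  then obtain \<gamma> where \<gamma>: "\<gamma> \<in> loops_at C a" and hom: "homotopic_paths S (?d1 +++ reversepath ?d2) (p \<circ> \<gamma>)"
    using loops by blast
  have "homotopic_paths S ?d1 (?d1 +++ linepath (p x) (p x))"
    using d ends by (intro homotopic_paths_sym[OF homotopic_paths_rid']) auto
  also have "homotopic_paths S \<dots> (?d1 +++ (reversepath ?d2 +++ ?d2))"
    using d ends homotopic_paths_linv[of ?d2 S]
    by (intro homotopic_paths_join) (auto simp: homotopic_paths_sym)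
  also have "homotopic_paths S \<dots> ((?d1 +++ reversepath ?d2) +++ ?d2)"
    using d ends by (intro homotopic_paths_assoc) auto
  also have "homotopic_paths S \<dots> ((p \<circ> \<gamma>) +++ ?d2)"
    using d ends by (intro homotopic_paths_join hom) auto
  also have "(p \<circ> \<gamma>) +++ ?d2 = p \<circ> (\<gamma> +++ c2)"
    by (simp add: path_compose_join)
  finally have "homotopic_paths S (p \<circ> c1) (p \<circ> (\<gamma> +++ c2))" .
  \<comment> \<open>Both lifts start at \<open>a\<close>; the first ends at \<open>x\<close> and the
    second, through \<open>c2\<close>, at \<open>y\<close>.\<close>
  then have "pathfinish c1 = pathfinish (\<gamma> +++ c2)"
    using c1 c2 \<gamma> by (intro covering_space_monodromy_topological[OF cov])
      (auto simp: loops_at_def subset_path_image_join)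
  then show "x = y" using c1 c2 by simp
qed

section \<open>Locally biholomorphic maps\<close>

text \<open>Balls in chart images pull back to path-connected neighbourhoods. Lying in the same path
  component is therefore locally constant, and connectedness leaves a single component.
  \<open>covering_space_inj_on\<close> requires this to join \<open>a\<close> to any two points of
  the covering.\<close>

lemma path_connected_manifold:
  fixes A :: "('a::topological_space, 'n::finite) chart set"
  assumes atlas: "complex_atlas M A" and "connected M"
  shows "path_connected M"
proof -
  have nbhd: "\<exists>W. openin (top_of_set M) W \<and> x \<in> W \<and> (\<forall>y\<in>W. path_component M x y)" if "x \<in> M" for x
  proof -
    obtain U \<phi> where U: "(U, \<phi>) \<in> A" "x \<in> U"
      using atlas \<open>x \<in> M\<close> unfolding complex_atlas_def by blast
    define q where "q = inv_into U \<phi>"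
    have op: "openin (top_of_set M) U" "open (\<phi> ` U)" and hom: "homeomorphism U (\<phi> ` U) \<phi> q"
      using atlas U(1) unfolding complex_atlas_def q_def by auto
    obtain e where e: "0 < e" "ball (\<phi> x) e \<subseteq> \<phi> ` U"
      using op(2) U(2) by (meson imageI open_contains_ball)
    let ?W = "q ` ball (\<phi> x) e"
    have "openin (top_of_set U) ?W"
      using e homeomorphism_imp_open_map[OF homeomorphism_symD[OF hom], of "ball (\<phi> x) e"] op(2)
      by (auto simp: openin_open_eq)
    then have W: "openin (top_of_set M) ?W"
      using op(1) by (rule openin_trans)
    have x: "x \<in> ?W"
      using hom U(2) e(1) by (metis centre_in_ball homeomorphism_apply1 imageI)
    have "path_connected ?W"
      using hom e(2) by (intro path_connected_continuous_image convex_imp_path_connected convex_ball)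
        (auto simp: homeomorphism_def intro: continuous_on_subset)
    moreover have "?W \<subseteq> M"
      using W openin_imp_subset by blast
    ultimately have "\<forall>y\<in>?W. path_component M x y"
      using x by (meson path_component_of_subset path_connected_component)
    then show ?thesis using W x by blast
  qed
  show ?thesis
    unfolding path_connected_component
  proof (intro ballI)
    fix x y assume "x \<in> M" "y \<in> M"
    then show "path_component M x y"
      by (rule connected_equivalence_relation[OF \<open>connected M\<close>])
        (auto intro: path_component_sym path_component_trans nbhd)
  qed
qed

section \<open>Holomorphy as a local property\<close>

text \<open>Since \<open>W\<close> is open, the derivative of \<open>g\<close> within
  \<open>W\<close> is a full derivative at \<open>z\<close>. It passes to \<open>f\<close>, which
  equals \<open>g\<close> near \<open>z\<close>, and then restricts to \<open>S\<close>.\<close>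

lemma holomorphic_Cn_locally:
  assumes "\<And>z. z \<in> S \<Longrightarrow> \<exists>W g. open W \<and> z \<in> W \<and> holomorphic_Cn W g \<and> (\<forall>w\<in>W. g w = f w)"
  shows "holomorphic_Cn S f"
  unfolding holomorphic_Cn_def
proof
  fix z assume "z \<in> S"
  then obtain W g where W: "open W" "z \<in> W" "holomorphic_Cn W g" and eq: "\<forall>w\<in>W. g w = f w"
    by (elim assms[THEN exE] exE conjE) (rule that)
  obtain D where "(g has_derivative D) (at z within W)" and D': "\<forall>c v. D (c *s v) = c * D v"
    using bspec[OF W(3)[unfolded holomorphic_Cn_def] W(2)] by (elim exE conjE) (rule that)
  then have D: "(g has_derivative D) (at z)"
    by (simp only: at_within_open[OF W(2,1)])
  have "(f has_derivative D) (at z within S)"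
    by (rule has_derivative_at_withinI[OF has_derivative_transform_within_open[OF D W(1,2) bspec[OF eq]]])
  then show "\<exists>D. (f has_derivative D) (at z within S) \<and> (\<forall>c v. D (c *s v) = c * D v)"
    using D' by blast
qed

lemma holomorphic_map_Cn_locally:
  assumes "\<And>z. z \<in> S \<Longrightarrow> \<exists>W g. open W \<and> z \<in> W \<and> holomorphic_map_Cn W g \<and> (\<forall>w\<in>W. g w = f w)"
  shows "holomorphic_map_Cn S f"
  unfolding holomorphic_map_Cn_def
proof
  fix i
  show "holomorphic_Cn S (\<lambda>z. f z $ i)"
  proof (rule holomorphic_Cn_locally)
    fix z assume "z \<in> S"
    then obtain W g where "open W" "z \<in> W" "holomorphic_map_Cn W g" "\<forall>w\<in>W. g w = f w"
      by (elim assms[THEN exE] exE conjE) (rule that)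
    then show "\<exists>W h. open W \<and> z \<in> W \<and> holomorphic_Cn W h \<and> (\<forall>w\<in>W. h w = f w $ i)"
      unfolding holomorphic_map_Cn_def by (intro exI[of _ W] exI[of _ "\<lambda>z. g z $ i"]) auto
  qed
qed

text \<open>Serves to remove \<open>inv_into V id\<close>, which the chart of \<open>V\<close>
  brings in and which is known to be the identity on \<open>V\<close>.\<close>

lemma holomorphic_map_Cn_cong:
  assumes "holomorphic_map_Cn S f" "\<And>z. z \<in> S \<Longrightarrow> g z = f z"
  shows "holomorphic_map_Cn S g"
  unfolding holomorphic_map_Cn_def holomorphic_Cn_def
proof (intro allI ballI)
  fix i z assume z: "z \<in> S"
  then obtain D where "((\<lambda>z. f z $ i) has_derivative D) (at z within S)" "\<forall>c v. D (c *s v) = c * D v"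
    using assms(1) unfolding holomorphic_map_Cn_def holomorphic_Cn_def by blast
  moreover from this(1) have "((\<lambda>z. g z $ i) has_derivative D) (at z within S)"
    by (rule has_derivative_transform[OF z, rotated]) (simp add: assms(2))
  ultimately show "\<exists>D. ((\<lambda>z. g z $ i) has_derivative D) (at z within S) \<and> (\<forall>c v. D (c *s v) = c * D v)"
    by blast
qed

text \<open>Unfolds local biholomorphy near \<open>x\<close> into a local inverse \<open>h\<close>,
  with the identity charts of the target eliminated. Only the charts of \<open>A\<close>, cut down
  to \<open>W\<close>, remain.\<close>

lemma locally_biholomorphic_local_inverse:
  fixes A :: "('a::topological_space, 'n::finite) chart set" and f :: "'a \<Rightarrow> complex^'n"
  assumes loc: "locally_biholomorphic M A UNIV (Cn_atlas UNIV) f" and "x \<in> M"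
  obtains W V h where "x \<in> W" "openin (top_of_set M) W" "open V"
    "continuous_on W f" "f \<in> W \<rightarrow> V" "continuous_on V h" "h \<in> V \<rightarrow> W"
    "\<And>y. y \<in> V \<Longrightarrow> f (h y) = y"
    "\<And>U \<phi>. (U, \<phi>) \<in> A \<Longrightarrow> holomorphic_map_Cn (\<phi> ` (U \<inter> W)) (f \<circ> inv_into (U \<inter> W) \<phi>)"
    "\<And>U \<phi>. (U, \<phi>) \<in> A \<Longrightarrow> holomorphic_map_Cn (V \<inter> h -` (U \<inter> W)) (\<phi> \<circ> h)"
proof -
  obtain W V where W: "x \<in> W" "openin (top_of_set M) W" "open V"
    and bi: "biholomorphic W (restrict_atlas A W) V (restrict_atlas (Cn_atlas UNIV) V) f"
    using loc \<open>x \<in> M\<close> unfolding locally_biholomorphic_def by auto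
  have V: "restrict_atlas (Cn_atlas UNIV) V = {(V, id)}"
    by (auto simp: restrict_atlas_def Cn_atlas_def)
  obtain h where f: "holomorphic_map W (restrict_atlas A W) V {(V, id)} f"
    and h: "holomorphic_map V {(V, id)} W (restrict_atlas A W) h"
    and fh: "\<And>y. y \<in> V \<Longrightarrow> f (h y) = y"
    using bi unfolding biholomorphic_def V by blast
  have maps: "f \<in> W \<rightarrow> V" "h \<in> V \<rightarrow> W" and cont: "continuous_on W f" "continuous_on V h"
    using f h unfolding holomorphic_map_def by auto
  have restrict: "(U \<inter> W, \<phi>) \<in> restrict_atlas A W" if "(U, \<phi>) \<in> A" for U \<phi>
    using that by (auto simp: restrict_atlas_def)
  have fhol: "holomorphic_map_Cn (\<phi> ` (U \<inter> W)) (f \<circ> inv_into (U \<inter> W) \<phi>)" if "(U, \<phi>) \<in> A" for U \<phi>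
  proof -
    have "holomorphic_map_Cn (\<phi> ` (U \<inter> W \<inter> f -` V)) (id \<circ> f \<circ> inv_into (U \<inter> W) \<phi>)"
      using f restrict[OF that] unfolding holomorphic_map_def by blast
    moreover have "U \<inter> W \<inter> f -` V = U \<inter> W" using maps(1) by auto
    ultimately show ?thesis by simp
  qed
  have hhol: "holomorphic_map_Cn (V \<inter> h -` (U \<inter> W)) (\<phi> \<circ> h)" if "(U, \<phi>) \<in> A" for U \<phi>
  proof (rule holomorphic_map_Cn_cong)
    show "holomorphic_map_Cn (V \<inter> h -` (U \<inter> W)) (\<phi> \<circ> h \<circ> inv_into V id)"
      using h restrict[OF that] unfolding holomorphic_map_def by auto
    show "(\<phi> \<circ> h) w = (\<phi> \<circ> h \<circ> inv_into V id) w" if "w \<in> V \<inter> h -` (U \<inter> W)" for w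
      using inv_into_f_f[of id V w] that by simp
  qed
  show ?thesis
    by (rule that[OF W cont(1) maps(1) cont(2) maps(2) fh fhol hhol])
qed

text \<open>By injectivity the global inverse \<open>g\<close> coincides with each local inverse
  \<open>h\<close> on its domain \<open>V\<close>. Continuity and holomorphy, being local, thus pass
  from the local biholomorphisms to \<open>f\<close> and from their inverses to
  \<open>g\<close>.\<close>

lemma biholomorphic_if_locally_biholomorphic_inj_on:
  fixes A :: "('a::topological_space, 'n::finite) chart set" and f :: "'a \<Rightarrow> complex^'n"
  assumes atlas: "complex_atlas M A"
    and loc: "locally_biholomorphic M A UNIV (Cn_atlas UNIV) f"
    and inj: "inj_on f M"
  shows "biholomorphic M A (f ` M) (Cn_atlas (f ` M)) f"
proof -
  define g where "g = inv_into M f"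
  have gf: "g (f x) = x" if "x \<in> M" for x
    using inj that by (simp add: g_def)
  have g_eq: "g y = h y" if "h y \<in> M" "f (h y) = y" for h y
    using gf[OF that(1)] that(2) by simp
  note local_inverse = locally_biholomorphic_local_inverse[OF loc]
  have "continuous_on M f"
    unfolding continuous_on_def
  proof
    fix x assume x: "x \<in> M"
    then obtain W where W: "x \<in> W" "openin (top_of_set M) W" "continuous_on W f"
      by (rule local_inverse) (rule that)
    obtain T where T: "open T" "W = M \<inter> T"
      using W(2) by (auto simp: openin_open)
    have "(f \<longlongrightarrow> f x) (at x within W)"
      using W(1,3) by (simp add: continuous_on_def)
    \<comment> \<open>\<open>T\<close> is an open neighbourhood of \<open>x\<close> that cuts out
      the same set from \<open>W\<close> as from \<open>M\<close>.\<close>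
    moreover have "at x within W = at x within M"
      using W(1) T by (intro at_within_nhd[of x T]) auto
    ultimately show "(f \<longlongrightarrow> f x) (at x within M)"
      by simp
  qed
  have "continuous_on (f ` M) g"
    unfolding continuous_on_eq_continuous_within
  proof
    fix y assume "y \<in> f ` M"
    then obtain x where x: "x \<in> M" "y = f x" by blast
    obtain W V h where W: "x \<in> W" "openin (top_of_set M) W" "open V" "f \<in> W \<rightarrow> V"
      and h: "continuous_on V h" "h \<in> V \<rightarrow> W" "\<And>y. y \<in> V \<Longrightarrow> f (h y) = y"
      using x(1) by (rule local_inverse) (rule that)
    have "g y = h y" if "y \<in> V" for y
      using g_eq[of h y] h(3)[OF that] Pi_mem[OF h(2) that] openin_imp_subset[OF W(2)] by blast
    then have "continuous_on V g"
      using h(1) by (simp cong: continuous_on_cong)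
    moreover have "y \<in> V" using x(2) Pi_mem[OF W(4,1)] by simp
    ultimately have "continuous (at y) g"
      using W(3) continuous_on_eq_continuous_at by blast
    then show "continuous (at y within f ` M) g"
      by (rule continuous_at_imp_continuous_at_within)
  qed
  have U_open: "openin (top_of_set M) U" "open (\<phi> ` U)" "homeomorphism U (\<phi> ` U) \<phi> (inv_into U \<phi>)"
    if "(U, \<phi>) \<in> A" for U \<phi>
    using atlas that unfolding complex_atlas_def by auto
  \<comment> \<open>Provides the open neighbourhoods in coordinates that
    \<open>holomorphic_map_Cn_locally\<close> asks for.\<close>
  have open_image: "open (\<phi> ` (U \<inter> W))" if "(U, \<phi>) \<in> A" "openin (top_of_set M) W" for U \<phi> W
  proof -
    have "openin (top_of_set U) (U \<inter> W)"
      using openin_Int[OF U_open(1)[OF that(1)] that(2)] inf_le1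
        openin_imp_subset[OF U_open(1)[OF that(1)]]
      by (rule openin_subset_trans)
    then show ?thesis
      using homeomorphism_imp_open_map[OF U_open(3)[OF that(1)]] U_open(2)[OF that(1)] openin_open_trans
      by blast
  qed
  have "holomorphic_map_Cn (\<phi> ` (U \<inter> f -` (f ` M))) (id \<circ> f \<circ> inv_into U \<phi>)" if U: "(U, \<phi>) \<in> A" for U \<phi>
  proof (rule holomorphic_map_Cn_locally)
    fix z assume "z \<in> \<phi> ` (U \<inter> f -` (f ` M))"
    then obtain x where x: "x \<in> U" "z = \<phi> x" by blast
    then have "x \<in> M" using openin_imp_subset[OF U_open(1)[OF U]] by blast
    then obtain W where W: "x \<in> W" "openin (top_of_set M) W"
      "\<And>U \<phi>. (U, \<phi>) \<in> A \<Longrightarrow> holomorphic_map_Cn (\<phi> ` (U \<inter> W)) (f \<circ> inv_into (U \<inter> W) \<phi>)"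
      by (rule local_inverse) (rule that)
    \<comment> \<open>Injectivity of the chart identifies the inverse chosen on
      \<open>U \<inter> W\<close> with the one chosen on \<open>U\<close>.\<close>
    have "inj_on \<phi> U"
      using U_open(3)[OF U] by (metis homeomorphism_def inj_on_inverseI)
    then have "inv_into (U \<inter> W) \<phi> w = inv_into U \<phi> w" if "w \<in> \<phi> ` (U \<inter> W)" for w
      using that by (auto simp: inj_on_Int)
    then have "\<forall>w\<in>\<phi> ` (U \<inter> W). (f \<circ> inv_into (U \<inter> W) \<phi>) w = (id \<circ> f \<circ> inv_into U \<phi>) w"
      by simp
    moreover have "z \<in> \<phi> ` (U \<inter> W)" using x W(1) by blast
    ultimately show "\<exists>W g. open W \<and> z \<in> W \<and> holomorphic_map_Cn W g \<and>
        (\<forall>w\<in>W. g w = (id \<circ> f \<circ> inv_into U \<phi>) w)"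
      using W(3)[OF U] open_image[OF U W(2)] by blast
  qed
  then have "holomorphic_map M A (f ` M) (Cn_atlas (f ` M)) f"
    using \<open>continuous_on M f\<close> by (auto simp: holomorphic_map_def Cn_atlas_def)
  moreover have "holomorphic_map_Cn (f ` M \<inter> g -` U) (\<phi> \<circ> g \<circ> inv_into (f ` M) id)"
    if U: "(U, \<phi>) \<in> A" for U \<phi>
  proof (rule holomorphic_map_Cn_locally)
    fix z assume "z \<in> f ` M \<inter> g -` U"
    then obtain x where x: "x \<in> M" "x \<in> U" "z = f x" using gf by auto
    obtain W V h where W: "x \<in> W" "openin (top_of_set M) W" "open V" "f \<in> W \<rightarrow> V"
      and h: "continuous_on V h" "h \<in> V \<rightarrow> W" "\<And>y. y \<in> V \<Longrightarrow> f (h y) = y"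
        "\<And>U \<phi>. (U, \<phi>) \<in> A \<Longrightarrow> holomorphic_map_Cn (V \<inter> h -` (U \<inter> W)) (\<phi> \<circ> h)"
      using x(1) by (rule local_inverse) (rule that)
    \<comment> \<open>The neighbourhood of \<open>z\<close> on which \<open>g = h\<close> takes
      values in the chart domain \<open>U\<close>; it contains \<open>z\<close> because
      \<open>h z = g z = x\<close>.\<close>
    let ?Y = "V \<inter> h -` (U \<inter> W)"
    have hM: "h y \<in> M" if "y \<in> V" for y
      using Pi_mem[OF h(2) that] openin_imp_subset[OF W(2)] by blast
    have gh: "g y = h y" if "y \<in> V" for y
      using g_eq hM h(3) that by blast
    have "openin (top_of_set V) ?Y"
      using hM by (intro continuous_openin_preimage[OF h(1) _ openin_Int[OF U_open(1)[OF U] W(2)]]) auto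
    then have "open ?Y" using W(3) openin_open_trans by blast
    moreover have "z \<in> ?Y"
      using Pi_mem[OF W(4,1)] gh[of z] gf[OF x(1)] x W(1) by auto
    moreover have "(\<phi> \<circ> h) w = (\<phi> \<circ> g \<circ> inv_into (f ` M) id) w" if "w \<in> ?Y" for w
    proof -
      have w: "w \<in> V" using that by blast
      then have "w \<in> f ` M" using h(3) hM by (metis imageI)
      then have "inv_into (f ` M) id w = w"
        using inv_into_f_f[of id "f ` M" w] by simp
      then show ?thesis using gh[OF w] by simp
    qed
    ultimately show "\<exists>W k. open W \<and> z \<in> W \<and> holomorphic_map_Cn W k \<and>
        (\<forall>w\<in>W. k w = (\<phi> \<circ> g \<circ> inv_into (f ` M) id) w)"
      using h(4)[OF U] by blast
  qed
  then have "holomorphic_map (f ` M) (Cn_atlas (f ` M)) M A g"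
    using \<open>continuous_on (f ` M) g\<close> gf by (auto simp: holomorphic_map_def Cn_atlas_def)
  moreover have "\<forall>y\<in>f ` M. f (g y) = y" "\<forall>x\<in>M. g (f x) = x"
    using gf by auto
  ultimately show ?thesis
    unfolding biholomorphic_def by blast
qed

section \<open>Schlichtness of the envelope\<close>

theorem theorem1:
  fixes \<Omega> :: "(complex^'n::finite) set"
    and M :: "'a::topological_space set"
    and A :: "('a, 'n) chart set"
    and \<pi> :: "'a \<Rightarrow> complex^'n"
    and \<alpha> :: "complex^'n \<Rightarrow> 'a"
    and p :: "complex^'n"
  assumes "is_domain \<Omega>"
    and "envelope_of_holomorphy \<Omega> M A \<pi> \<alpha>"
    and "p \<in> \<Omega>"
    and "covering_space M \<pi> (\<pi> ` M)"
    and "induced_map (\<pi> ` M) (\<pi> \<circ> \<alpha>) ` carrier (fundamental_group \<Omega> p)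
           = carrier (fundamental_group (\<pi> ` M) p)"
  shows "schlicht M A \<pi>"
proof -
  have atlas: "complex_atlas M A" and "connected M"
    and loc: "locally_biholomorphic M A UNIV (Cn_atlas UNIV) \<pi>"
    and \<alpha>: "\<alpha> \<in> \<Omega> \<rightarrow> M" "continuous_on \<Omega> \<alpha>" and \<pi>\<alpha>: "\<And>z. z \<in> \<Omega> \<Longrightarrow> \<pi> (\<alpha> z) = z"
    using assms(2)
    by (auto simp: envelope_of_holomorphy_def stein_manifold_def complex_manifold_def holomorphic_map_def)
  have cont: "continuous_on \<Omega> (\<pi> \<circ> \<alpha>)"
    by (rule continuous_on_eq[OF continuous_on_id]) (simp add: \<pi>\<alpha>)
  have maps: "\<pi> \<circ> \<alpha> \<in> \<Omega> \<rightarrow> \<pi> ` M"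
    using Pi_mem[OF \<alpha>(1)] by (intro Pi_I) simp
  have "inj_on \<pi> M"
  proof (rule covering_space_inj_on[OF assms(4) path_connected_manifold[OF atlas \<open>connected M\<close>]])
    show "\<alpha> p \<in> M" using \<alpha> \<open>p \<in> \<Omega>\<close> by auto
  next
    fix g assume "g \<in> loops_at (\<pi> ` M) (\<pi> (\<alpha> p))"
    then have g: "g \<in> loops_at (\<pi> ` M) p" using \<pi>\<alpha> \<open>p \<in> \<Omega>\<close> by simp
    \<comment> \<open>Surjectivity on fundamental groups enters here: the class of \<open>g\<close>
      comes from a loop \<open>c\<close> in \<open>\<Omega>\<close>.\<close>
    then have "path_class (\<pi> ` M) g \<in> induced_map (\<pi> ` M) (\<pi> \<circ> \<alpha>) ` path_class \<Omega> ` loops_at \<Omega> p"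
      using assms(5) by (simp add: fundamental_group_def)
    then obtain c where c: "c \<in> loops_at \<Omega> p"
      and "path_class (\<pi> ` M) g = path_class (\<pi> ` M) ((\<pi> \<circ> \<alpha>) \<circ> c)"
      using induced_map_path_class[OF _ cont maps] by auto
    then have "homotopic_paths (\<pi> ` M) ((\<pi> \<circ> \<alpha>) \<circ> c) g"
      using path_class_eqD[OF _ g] by metis
    \<comment> \<open>Reassociating the composition turns \<open>c\<close> into the projection of
      the loop \<open>\<alpha> \<circ> c\<close>, which lies in \<open>M\<close> and is based at
      \<open>\<alpha> p\<close>.\<close>
    then have "homotopic_paths (\<pi> ` M) g (\<pi> \<circ> (\<alpha> \<circ> c))"
      by (simp add: homotopic_paths_sym comp_assoc)
    moreover have "\<alpha> \<circ> c \<in> loops_at M (\<alpha> p)"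
      using c \<alpha>
      by (auto simp: loops_at_def path_image_compose pathstart_compose pathfinish_compose
        intro!: path_continuous_image intro: continuous_on_subset)
    ultimately show "\<exists>c\<in>loops_at M (\<alpha> p). homotopic_paths (\<pi> ` M) g (\<pi> \<circ> c)"
      by blast
  qed
  then show ?thesis
    unfolding schlicht_def by (rule biholomorphic_if_locally_biholomorphic_inj_on[OF atlas loc])
qed

end
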